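(* Let $\delta>0$ be sufficiently small and let $\alpha=1/(100\log(1/\delta))$. Any (randomized) algorithm that solves the problem Detect-High$(\delta)$ must access $\Omega(1/\sqrt{\delta})$ edges of the input graph (in the worst case over inputs).
   Context: For a directed graph $G$ in which every node has out-degree at least $1$ (undirected graphs are viewed as directed graphs with both orientations of each edge), the personalized PageRank $\pi_s(t)$ is $\mathbb{P}[V_L=t]$, where $V_0=s,V_1,\dots$ is the random walk that moves to a uniformly random out-neighbour at each step and $L$ is independent with $\mathbb{P}[L=i]=\alpha(1-\alpha)^i$, $i\ge0$. The problem Detect-High$(\delta)$: given access to a graph $G$ and two nodes $s,t$, for all pairs $(s,t)$, if $\pi_s(t)>\delta$ the algorithm must output ACCEPT with probability $>9/10$, and if $\pi_s(t)<\delta/2$ it must output REJECT with probability $>9/10$; the probabilities are over the algorithm's internal randomness only. The algorithm accesses the graph through edge (neighbour) queries, and the complexity measure is the number of edges accessed. *)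

theory Defs
  imports "HOL-Probability.Probability" "Graph_Theory.Pair_Digraph"
begin

section \<open>Personalized PageRank\<close>

definition out_nbrs :: "'a pair_pre_digraph \<Rightarrow> 'a \<Rightarrow> 'a set" where
  "out_nbrs G v = {w. (v, w) \<in> parcs G}"

definition in_nbrs :: "'a pair_pre_digraph \<Rightarrow> 'a \<Rightarrow> 'a set" where
  "in_nbrs G v = {u. (u, v) \<in> parcs G}"

text \<open>
  Distribution of \<open>V\<^sub>i\<close> for the random walk started at \<open>s\<close>. It is meaningful when every node has
  finite out-degree at least 1, since \<^const>\<open>pmf_of_set\<close> needs a finite nonempty set.
\<close>

primrec walk_pmf :: "'a pair_pre_digraph \<Rightarrow> 'a \<Rightarrow> nat \<Rightarrow> 'a pmf" where
  "walk_pmf G s 0 = return_pmf s"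
| "walk_pmf G s (Suc i) = bind_pmf (walk_pmf G s i) (\<lambda>v. pmf_of_set (out_nbrs G v))"

text \<open>
  The length has \<open>P(L = i) = \<alpha> (1 - \<alpha>)\<^sup>i\<close>, which is the library's \<^const>\<open>geometric_pmf\<close>
  for \<open>0 < \<alpha> \<le> 1\<close>.
\<close>

definition ppr :: "real \<Rightarrow> 'a pair_pre_digraph \<Rightarrow> 'a \<Rightarrow> 'a \<Rightarrow> real" where
  "ppr \<alpha> G s t = pmf (bind_pmf (geometric_pmf \<alpha>) (walk_pmf G s)) t"


section \<open>Inputs and neighbour queries\<close>

text \<open>
  An input consists of a graph, the two nodes, and the order in which the out- and in-neighbours
  of each node are listed. The order is arbitrary and is what gives meaning to
  ``the \<open>i\<close>-th neighbour of \<open>v\<close>''.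
\<close>

record input =
  graph :: "nat pair_pre_digraph"
  out_list :: "nat \<Rightarrow> nat list"
  in_list :: "nat \<Rightarrow> nat list"
  source :: nat
  target :: nat

definition valid_input :: "input \<Rightarrow> bool" where
  "valid_input I \<longleftrightarrow>
     pair_digraph (graph I) \<and>
     (\<forall>v \<in> pverts (graph I). 1 \<le> out_degree (with_proj (graph I)) v) \<and>
     source I \<in> pverts (graph I) \<and> target I \<in> pverts (graph I) \<and>
     (\<forall>v. distinct (out_list I v) \<and> set (out_list I v) = out_nbrs (graph I) v) \<and>
     (\<forall>v. distinct (in_list I v) \<and> set (in_list I v) = in_nbrs (graph I) v)"

datatype query = Out_Nbr nat nat | In_Nbr nat nat

text \<open>The edge revealed by a query; nothing is revealed if the node has too few neighbours.\<close>

fun access :: "input \<Rightarrow> query \<Rightarrow> (nat \<times> nat) option" where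
  "access I (Out_Nbr v i) =
     (if i < length (out_list I v) then Some (v, out_list I v ! i) else None)"
| "access I (In_Nbr v i) =
     (if i < length (in_list I v) then Some (in_list I v ! i, v) else None)"


section \<open>Randomized algorithms\<close>

datatype decision = ACCEPT | REJECT

datatype action = Output decision | Ask query "(nat \<times> nat) option \<Rightarrow> nat"

text \<open>
  The contents of the memory of an algorithm (which may record all earlier answers and coin
  tosses) are coded by a natural number. The algorithm is told the node set and the two nodes.
  In each step it chooses, at random depending on its memory, to stop with a decision or to ask
  a query; in the latter case the answer determines the next memory contents.
  No restriction is made on computability, running time or termination.
\<close>

record algorithm =
  start :: "nat set \<Rightarrow> nat \<Rightarrow> nat \<Rightarrow> nat"
  step :: "nat \<Rightarrow> action pmf"

text \<open>
  A state of a run is the set of edges accessed so far, together with the memory (\<^const>\<open>Inl\<close>)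
  or, once the algorithm has stopped, its decision (\<^const>\<open>Inr\<close>).
\<close>

type_synonym state = "(nat \<times> nat) set \<times> (nat + decision)"

fun perform :: "input \<Rightarrow> (nat \<times> nat) set \<Rightarrow> action \<Rightarrow> state" where
  "perform I F (Output d) = (F, Inr d)"
| "perform I F (Ask q k) = (F \<union> set_option (access I q), Inl (k (access I q)))"

fun advance :: "algorithm \<Rightarrow> input \<Rightarrow> state \<Rightarrow> state pmf" where
  "advance A I (F, Inl m) = map_pmf (perform I F) (step A m)"
| "advance A I (F, Inr d) = return_pmf (F, Inr d)"

primrec run :: "algorithm \<Rightarrow> input \<Rightarrow> nat \<Rightarrow> state pmf" where
  "run A I 0 = return_pmf ({}, Inl (start A (pverts (graph I)) (source I) (target I)))"
| "run A I (Suc k) = bind_pmf (run A I k) (advance A I)"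

text \<open>
  A run need not terminate, so the probability of an output and the expected number of edges
  accessed are limits over the number of steps. Both are nondecreasing in that number,
  hence the suprema.
\<close>

definition output_prob :: "algorithm \<Rightarrow> input \<Rightarrow> decision \<Rightarrow> real" where
  "output_prob A I d = (SUP k. measure_pmf.prob (run A I k) {x. snd x = Inr d})"

definition expected_edges :: "algorithm \<Rightarrow> input \<Rightarrow> ennreal" where
  "expected_edges A I = (SUP k. \<integral>\<^sup>+ x. of_nat (card (fst x)) \<partial>measure_pmf (run A I k))"

definition worst_case_edges :: "algorithm \<Rightarrow> ennreal" where
  "worst_case_edges A = (SUP I \<in> Collect valid_input. expected_edges A I)"


section \<open>The detection problem\<close>

definition solves_detect_high :: "real \<Rightarrow> real \<Rightarrow> algorithm \<Rightarrow> bool" where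
  "solves_detect_high \<alpha> \<delta> A \<longleftrightarrow>
     (\<forall>I. valid_input I \<longrightarrow>
        (ppr \<alpha> (graph I) (source I) (target I) > \<delta> \<longrightarrow> output_prob A I ACCEPT > 9 / 10) \<and>
        (ppr \<alpha> (graph I) (source I) (target I) < \<delta> / 2 \<longrightarrow> output_prob A I REJECT > 9 / 10))"

end

theory Submission
  imports Defs "HOL-Real_Asymp.Real_Asymp"
begin

text \<open>
  The hard inputs are directed graphs \<open>0 \<rightarrow> u\<^sub>i \<rightarrow> 2\<close> and \<open>w\<^sub>i \<rightarrow> 1\<close> for \<open>i < N = \<lceil>1 / sqrt \<delta>\<rceil>\<close>, with
  \<open>1 \<rightarrow> 0\<close> and \<open>2 \<rightarrow> 0\<close>, source 0 and target 1. The target is unreachable, but swapping the heads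
  of the two edges \<open>u\<^sub>j \<rightarrow> 2\<close> and \<open>w\<^sub>j \<rightarrow> 1\<close> for one index \<open>j\<close> raises its PageRank to at least
  \<open>\<alpha> (1 - \<alpha>)\<^sup>2 / N\<close>, which exceeds \<open>\<delta>\<close> because \<open>\<alpha>\<close> is only logarithmically small. The swap
  preserves all degrees, so it changes the answer of a query only if that answer reveals one of
  the edges involved. These sets of edges are disjoint for different \<open>j\<close>. On the unswapped graph
  each of them must be hit with probability at least 4/5, hence the expected number of edges
  accessed there is at least \<open>4 N / 5\<close>.
\<close>

section \<open>Runs on inputs that differ in a few edges\<close>

text \<open>Both integrals are weighted sums over points, so \<open>p\<close> and \<open>q\<close>
  have to agree only where an integrand is nonzero. This allows comparing runs on two inputs that
  agree on only some states.\<close>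

lemma nn_integral_pmf_cong:
  fixes p q :: "'a pmf"
  assumes "\<And>x. f x \<noteq> 0 \<or> g x \<noteq> 0 \<Longrightarrow> pmf p x = pmf q x \<and> f x = g x"
  shows "(\<integral>\<^sup>+x. f x \<partial>measure_pmf p) = (\<integral>\<^sup>+x. g x \<partial>measure_pmf q)"
proof -
  have "ennreal (pmf p x) * f x = ennreal (pmf q x) * g x" for x
    using assms[of x] by (cases "f x = 0 \<and> g x = 0") auto
  then show ?thesis
    by (simp add: nn_integral_measure_pmf)
qed

lemma measure_pmf_eq_on:
  assumes "\<And>x. x \<in> S \<Longrightarrow> pmf p x = pmf q x"
  shows "measure_pmf.prob p S = measure_pmf.prob q S"
proof -
  have "(\<integral>\<^sup>+x. indicator S x \<partial>measure_pmf p) = (\<integral>\<^sup>+x. indicator S x \<partial>measure_pmf q)"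
    by (rule nn_integral_pmf_cong) (auto simp: assms indicator_def)
  then have "emeasure (measure_pmf p) S = emeasure (measure_pmf q) S"
    by simp
  then show ?thesis
    by (simp add: measure_def)
qed

text \<open>Keeps a single term of the mixture; used to bound a random walk from below by one
  path.\<close>

lemma pmf_bind_ge: "pmf p x * pmf (f x) y \<le> pmf (bind_pmf p f) y"
proof -
  have "ennreal (pmf p x * pmf (f x) y) = (\<integral>\<^sup>+z. ennreal (pmf (f x) y) * indicator {x} z \<partial>measure_pmf p)"
    by (simp add: nn_integral_cmult_indicator emeasure_pmf_single ennreal_mult mult.commute)
  also have "\<dots> \<le> (\<integral>\<^sup>+z. ennreal (pmf (f z) y) \<partial>measure_pmf p)"
    by (intro nn_integral_mono) (auto simp: indicator_def)
  also have "\<dots> = ennreal (pmf (bind_pmf p f) y)"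
    by (rule ennreal_pmf_bind[symmetric])
  finally show ?thesis by simp
qed

section \<open>Monotonicity of runs in the number of steps\<close>

lemma advance_mono: "y \<in> set_pmf (advance A I x) \<Longrightarrow> fst x \<subseteq> fst y"
proof (cases "(A, I, x)" rule: advance.cases)
  case (1 A' I' F m)
  moreover assume "y \<in> set_pmf (advance A I x)"
  moreover have "F \<subseteq> fst (perform I F a)" for a by (cases a) auto
  ultimately show ?thesis by auto
qed auto

lemma finite_run: "x \<in> set_pmf (run A I k) \<Longrightarrow> finite (fst x)"
proof (induction k arbitrary: x)
  case (Suc k)
  then obtain y where y: "y \<in> set_pmf (run A I k)" "x \<in> set_pmf (advance A I y)"
    by auto
  have "finite (fst (perform I F a))" if "finite F" for F a
    using that by (cases a) auto
  with y Suc.IH[OF y(1)] show ?case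
    by (cases "(A, I, y)" rule: advance.cases) auto
qed auto

text \<open>Mass never leaves a set closed under \<open>advance\<close>; the stopped states with a
  given decision form such a set.\<close>

lemma prob_run_mono:
  assumes S: "\<And>x y. x \<in> S \<Longrightarrow> y \<in> set_pmf (advance A I x) \<Longrightarrow> y \<in> S"
  shows "mono (\<lambda>k. measure_pmf.prob (run A I k) S)"
proof (rule incseq_SucI)
  fix k
  have "emeasure (run A I k) S = (\<integral>\<^sup>+x. indicator S x \<partial>run A I k)" by simp
  also have "\<dots> \<le> (\<integral>\<^sup>+x. emeasure (advance A I x) S \<partial>run A I k)"
  proof (rule nn_integral_mono)
    fix x
    show "indicator S x \<le> emeasure (advance A I x) S"
    proof (cases "x \<in> S")
      case True
      then have "measure_pmf.prob (advance A I x) S = 1"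
        using S by (simp add: measure_pmf.prob_eq_1 AE_measure_pmf_iff)
      then show ?thesis by (simp add: measure_pmf.emeasure_eq_measure True)
    qed simp
  qed
  also have "\<dots> = emeasure (run A I (Suc k)) S" by simp
  finally show "measure_pmf.prob (run A I k) S \<le> measure_pmf.prob (run A I (Suc k)) S"
    by (simp add: measure_pmf.emeasure_eq_measure)
qed

lemma prob_output_mono: "mono (\<lambda>k. measure_pmf.prob (run A I k) {x. snd x = Inr d})"
  by (rule prob_run_mono) auto

text \<open>Reduces the limit to a finite number of steps; the supremum is well behaved because
  probabilities are bounded by 1.\<close>

lemma output_prob_gt_iff:
  "c < output_prob A I d \<longleftrightarrow> (\<exists>k. c < measure_pmf.prob (run A I k) {x. snd x = Inr d})"
  unfolding output_prob_def
  by (subst less_cSUP_iff) (auto intro!: bdd_aboveI[of _ 1])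

section \<open>Comparing runs on two inputs\<close>

text \<open>A differing answer has to reveal an edge of \<open>D\<close> on both inputs, so a state
  whose edges avoid \<open>D\<close> arises from the same actions on either one.\<close>

locale differ_on =
  fixes I J :: input and D :: "(nat \<times> nat) set"
  assumes same_start: "pverts (graph I) = pverts (graph J)" "source I = source J" "target I = target J"
    and differ: "access I q \<noteq> access J q \<Longrightarrow>
      set_option (access I q) \<inter> D \<noteq> {} \<and> set_option (access J q) \<inter> D \<noteq> {}"
begin

lemma pmf_advance_eq:
  assumes "fst x \<inter> D = {}"
  shows "pmf (advance A I y) x = pmf (advance A J y) x"
proof (cases "(A, I, y)" rule: advance.cases)
  case (1 A' I' F m)
  have "perform I F a = x \<longleftrightarrow> perform J F a = x" for a
  proof (cases a)
    case (Ask q f)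
    then show ?thesis using differ[of q] assms by (cases "access I q = access J q") auto
  qed simp
  then have "perform I F -` {x} = perform J F -` {x}" by auto
  with 1 show ?thesis by (simp add: pmf_map)
qed auto

text \<open>Edge sets only grow, so every predecessor of a state avoiding \<open>D\<close> avoids it
  as well and is covered by the induction hypothesis.\<close>

lemma pmf_run_eq:
  assumes "fst x \<inter> D = {}"
  shows "pmf (run A I k) x = pmf (run A J k) x"
  using assms
proof (induction k arbitrary: x)
  case 0
  then show ?case by (simp add: same_start)
next
  case (Suc k)
  have *: "fst y \<inter> D = {}" if "pmf (advance A K y) x \<noteq> 0" for y K
    using advance_mono[of x A K y] that Suc.prems by (auto simp: set_pmf_iff)
  have "ennreal (pmf (run A I (Suc k)) x) = ennreal (pmf (run A J (Suc k)) x)"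
    unfolding run.simps ennreal_pmf_bind
    by (rule nn_integral_pmf_cong)
       (use * Suc.IH pmf_advance_eq[OF Suc.prems] in \<open>auto simp: ennreal_eq_0_iff\<close>)
  then show ?case by simp
qed

text \<open>The runs agree off the hit event, hence the hit event, as a complement, has equal
  probability on both. Hits can thus be charged to \<open>I\<close>, the common reference for all
  swaps.\<close>

lemma prob_le_prob_add_hit:
  "measure_pmf.prob (run A J k) S \<le>
     measure_pmf.prob (run A I k) S + measure_pmf.prob (run A I k) {x. fst x \<inter> D \<noteq> {}}"
proof -
  let ?P = "\<lambda>K. measure_pmf.prob (run A K k)" and ?H = "{x. fst x \<inter> D \<noteq> {}}"
  have eq: "?P I (T - ?H) = ?P J (T - ?H)" for T
    by (intro measure_pmf_eq_on pmf_run_eq) auto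
  have compl: "?P K ?H = 1 - ?P K (UNIV - ?H)" for K
    using measure_pmf.prob_compl[of ?H "run A K k"] by simp
  have "?P J S \<le> ?P J ((S - ?H) \<union> ?H)"
    by (intro measure_pmf.finite_measure_mono) auto
  also have "\<dots> \<le> ?P J (S - ?H) + ?P J ?H"
    by (intro measure_Un_le) auto
  also have "\<dots> = ?P I (S - ?H) + ?P I ?H"
    by (simp only: eq compl)
  also have "?P I (S - ?H) \<le> ?P I S"
    by (intro measure_pmf.finite_measure_mono) auto
  finally show ?thesis by simp
qed

end

section \<open>From hit probabilities to expected edges\<close>

text \<open>Picking one edge of \<open>F\<close> in each hit set is injective by
  disjointness.\<close>

lemma card_hit_le:
  assumes "finite F" "finite J" and disj: "disjoint_family_on D J"
  shows "card {j \<in> J. F \<inter> D j \<noteq> {}} \<le> card F"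
proof -
  have "\<forall>j \<in> {j \<in> J. F \<inter> D j \<noteq> {}}. \<exists>e. e \<in> F \<inter> D j" by blast
  then obtain e where e: "\<And>j. j \<in> J \<Longrightarrow> F \<inter> D j \<noteq> {} \<Longrightarrow> e j \<in> F \<inter> D j"
    by (metis (mono_tags, lifting) mem_Collect_eq)
  show ?thesis
  proof (rule card_inj_on_le[of e])
    show "inj_on e {j \<in> J. F \<inter> D j \<noteq> {}}"
    proof (rule inj_onI, rule ccontr)
      fix i j
      assume "i \<in> {j \<in> J. F \<inter> D j \<noteq> {}}" "j \<in> {j \<in> J. F \<inter> D j \<noteq> {}}" "e i = e j" "i \<noteq> j"
      then show False
        using e[of i] e[of j] disjoint_family_onD[OF disj, of i j] by auto
    qed
  qed (use e assms in auto)
qed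

text \<open>Linearity of expectation, applied to the number of sets \<open>D j\<close> that are
  hit.\<close>

lemma sum_prob_hit_le:
  assumes "finite J" "disjoint_family_on D J"
  shows "ennreal (\<Sum>j\<in>J. measure_pmf.prob (run A I k) {x. fst x \<inter> D j \<noteq> {}}) \<le> expected_edges A I"
proof -
  let ?H = "\<lambda>j. {x :: state. fst x \<inter> D j \<noteq> {}}"
  have "ennreal (\<Sum>j\<in>J. measure_pmf.prob (run A I k) (?H j))
      = (\<Sum>j\<in>J. \<integral>\<^sup>+x. indicator (?H j) x \<partial>run A I k)"
    by (simp add: measure_pmf.emeasure_eq_measure)
  also have "\<dots> = (\<integral>\<^sup>+x. (\<Sum>j\<in>J. indicator (?H j) x) \<partial>run A I k)"
    by (rule nn_integral_sum[symmetric]) simp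
  also have "\<dots> \<le> (\<integral>\<^sup>+x. of_nat (card (fst x)) \<partial>run A I k)"
  proof (rule nn_integral_mono_AE, unfold AE_measure_pmf_iff, rule ballI)
    fix x assume "x \<in> set_pmf (run A I k)"
    then have "card {j \<in> J. fst x \<inter> D j \<noteq> {}} \<le> card (fst x)"
      by (intro card_hit_le finite_run assms)
    moreover have "(\<Sum>j\<in>J. indicator (?H j) x) = (of_nat (card {j \<in> J. fst x \<inter> D j \<noteq> {}}) :: ennreal)"
      using assms(1) by (simp add: indicator_def sum.If_cases Int_def)
    ultimately show "(\<Sum>j\<in>J. indicator (?H j) x) \<le> (of_nat (card (fst x)) :: ennreal)"
      by simp
  qed
  also have "\<dots> \<le> expected_edges A I"
    unfolding expected_edges_def by (rule SUP_upper) simp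
  finally show ?thesis .
qed

lemma expected_edges_ge:
  fixes J :: "'j \<Rightarrow> input"
  assumes "finite X" "disjoint_family_on D X"
    and differ: "\<And>j. j \<in> X \<Longrightarrow> differ_on I (J j) (D j)"
    and rej: "output_prob A I REJECT > 9 / 10"
    and acc: "\<And>j. j \<in> X \<Longrightarrow> output_prob A (J j) ACCEPT > 9 / 10"
  shows "ennreal (4 / 5 * card X) \<le> expected_edges A I"
proof -
  let ?P = "\<lambda>K k d. measure_pmf.prob (run A K k) {x. snd x = Inr d}"
  obtain k0 where k0: "9 / 10 < ?P I k0 REJECT"
    using rej by (auto simp: output_prob_gt_iff)
  obtain k where k: "\<And>j. j \<in> X \<Longrightarrow> 9 / 10 < ?P (J j) (k j) ACCEPT"
    using acc unfolding output_prob_gt_iff by metis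
  \<comment> \<open>A common number of steps: \<open>X\<close> is finite and output probabilities
    are monotone, so all strict bounds hold at \<open>K\<close>.\<close>
  define K where "K = Max (insert k0 (k ` X))"
  have K: "k0 \<le> K" "\<And>j. j \<in> X \<Longrightarrow> k j \<le> K"
    using assms(1) by (auto simp: K_def)
  have "?P I K ACCEPT + ?P I K REJECT
      = measure_pmf.prob (run A I K) ({x. snd x = Inr ACCEPT} \<union> {x. snd x = Inr REJECT})"
    by (intro measure_pmf.finite_measure_Union[symmetric]) auto
  also have "\<dots> \<le> 1" by simp
  finally have "?P I K ACCEPT < 1 / 10"
    using k0 monoD[OF prob_output_mono K(1), of A I REJECT] by simp
  \<comment> \<open>ACCEPT has probability above 9/10 on \<open>J j\<close> and below 1/10 on
    \<open>I\<close>; hits must account for the gap.\<close>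
  then have "4 / 5 \<le> measure_pmf.prob (run A I K) {x. fst x \<inter> D j \<noteq> {}}" if "j \<in> X" for j
    using k[OF that] monoD[OF prob_output_mono K(2)[OF that], of A "J j" ACCEPT]
      differ_on.prob_le_prob_add_hit[OF differ[OF that], of A K "{x. snd x = Inr ACCEPT}"]
    by simp
  then have "4 / 5 * card X \<le> (\<Sum>j\<in>X. measure_pmf.prob (run A I K) {x. fst x \<inter> D j \<noteq> {}})"
    using sum_mono[of X "\<lambda>_. 4 / 5 :: real"] by fastforce
  from order_trans[OF ennreal_leI[OF this] sum_prob_hit_le[OF assms(1,2)]]
  show ?thesis .
qed


section \<open>The hard inputs\<close>

text \<open>
  \<open>u\<^sub>i\<close> and \<open>w\<^sub>i\<close> are coded as \<open>2 i + 3\<close> and \<open>2 i + 4\<close>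
  for \<open>i < N\<close>. The index \<open>j\<close> selects the swapped pair; no pair is swapped if \<open>j \<ge> N\<close>.
\<close>

definition hard_out :: "nat \<Rightarrow> nat \<Rightarrow> nat \<Rightarrow> nat list" where
  "hard_out N j v =
     (if v = 0 then map (\<lambda>i. 2 * i + 3) [0..<N]
      else if v \<le> 2 then [0]
      else if v < 2 * N + 3 then [if odd v \<longleftrightarrow> v \<in> {2 * j + 3, 2 * j + 4} then 1 else 2]
      else [])"

text \<open>For nodes 1 and 2, position \<open>i\<close> holds whichever of
  \<open>u\<^sub>i\<close>, \<open>w\<^sub>i\<close> points there, so the swap changes only position
  \<open>j\<close>.\<close>

definition hard_in :: "nat \<Rightarrow> nat \<Rightarrow> nat \<Rightarrow> nat list" where
  "hard_in N j v =
     (if v = 0 then [1, 2]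
      else if v = 1 then map (\<lambda>i. if i = j then 2 * i + 3 else 2 * i + 4) [0..<N]
      else if v = 2 then map (\<lambda>i. if i = j then 2 * i + 4 else 2 * i + 3) [0..<N]
      else if odd v \<and> v < 2 * N + 3 then [0]
      else [])"

definition hard_input :: "nat \<Rightarrow> nat \<Rightarrow> input" where
  "hard_input N j =
     \<lparr>graph = \<lparr>pverts = {..<2 * N + 3}, parcs = {(v, w). w \<in> set (hard_out N j v)}\<rparr>,
      out_list = hard_out N j, in_list = hard_in N j, source = 0, target = 1\<rparr>"

lemma hard_input_simps [simp]:
  "pverts (graph (hard_input N j)) = {..<2 * N + 3}"
  "out_list (hard_input N j) = hard_out N j"
  "in_list (hard_input N j) = hard_in N j"
  "source (hard_input N j) = 0"
  "target (hard_input N j) = 1"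
  by (simp_all add: hard_input_def)

lemma out_nbrs_hard_input [simp]: "out_nbrs (graph (hard_input N j)) v = set (hard_out N j v)"
  by (simp add: out_nbrs_def hard_input_def)

lemma nat_code_cases:
  obtains "v = 0" | "v = 1" | "v = 2" | i where "v = 2 * i + 3" | i where "v = 2 * i + (4::nat)"
proof -
  have "v = 0 \<or> v = 1 \<or> v = 2 \<or> (\<exists>i. v = 2 * i + 3) \<or> (\<exists>i. v = 2 * i + 4)"
    by presburger
  with that show thesis by blast
qed

lemma set_hard_in: "set (hard_in N j v) = {u. v \<in> set (hard_out N j u)}"
proof (rule set_eqI)
  fix u
  show "u \<in> set (hard_in N j v) \<longleftrightarrow> u \<in> {u. v \<in> set (hard_out N j u)}"
    by (cases u rule: nat_code_cases; cases v rule: nat_code_cases)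
       (auto simp: hard_in_def hard_out_def Suc_double_not_eq_double double_not_eq_Suc_double)
qed

lemma valid_hard_input:
  assumes "N > 0"
  shows "valid_input (hard_input N j)"
proof -
  let ?G = "graph (hard_input N j)"
  have parcs: "parcs ?G = {(v, w). w \<in> set (hard_out N j v)}"
    by (simp add: hard_input_def)
  have arcs: "v < 2 * N + 3 \<and> w < 2 * N + 3 \<and> v \<noteq> w" if "w \<in> set (hard_out N j v)" for v w
    using that assms by (auto simp: hard_out_def split: if_splits)
  then have "finite (parcs ?G)"
    by (intro finite_subset[of "parcs ?G" "{..<2 * N + 3} \<times> {..<2 * N + 3}"]) (auto simp: parcs)
  then have "pair_digraph ?G"
    by unfold_locales (use arcs in \<open>auto simp: parcs\<close>)
  moreover have "1 \<le> out_degree (with_proj ?G) v" if "v < 2 * N + 3" for v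
  proof -
    have "out_arcs (with_proj ?G) v = Pair v ` set (hard_out N j v)"
      by (auto simp: out_arcs_def parcs)
    moreover have "hard_out N j v \<noteq> []"
      using that assms by (simp add: hard_out_def)
    ultimately show ?thesis
      by (simp add: out_degree_def card_image inj_on_def Suc_le_eq card_gt_0_iff)
  qed
  moreover have "distinct (hard_out N j v)" "distinct (hard_in N j v)" for v
    by (auto simp: hard_out_def hard_in_def distinct_map inj_on_def split: if_splits; presburger)+
  moreover have "set (hard_in N j v) = in_nbrs ?G v" for v
    by (simp add: in_nbrs_def parcs set_hard_in)
  ultimately show ?thesis
    by (simp add: valid_input_def)
qed

text \<open>Contains the two edges before the swap and the two after it, so that a noticed
  difference hits the set on either input.\<close>

definition swap_edges :: "nat \<Rightarrow> (nat \<times> nat) set" where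
  "swap_edges j = {2 * j + 3, 2 * j + 4} \<times> {1, 2}"

lemma disjoint_swap_edges: "disjoint_family_on swap_edges X"
  unfolding disjoint_family_on_def swap_edges_def by (auto; presburger)

text \<open>Only out-queries at \<open>u\<^sub>j\<close>, \<open>w\<^sub>j\<close> and in-queries at
  position \<open>j\<close> of 1 or 2 can differ. Degrees are unchanged, so no answer is
  \<open>None\<close> on just one input.\<close>

lemma differ_on_hard_input:
  assumes "j < N"
  shows "differ_on (hard_input N N) (hard_input N j) (swap_edges j)"
proof
  fix q
  assume "access (hard_input N N) q \<noteq> access (hard_input N j) q"
  then show "set_option (access (hard_input N N) q) \<inter> swap_edges j \<noteq> {} \<and>
      set_option (access (hard_input N j) q) \<inter> swap_edges j \<noteq> {}"
    using assms
    by (cases q) (auto simp: hard_out_def hard_in_def swap_edges_def split: if_splits)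
qed simp_all

section \<open>PageRank of the target\<close>

text \<open>Without a swap, the nodes 0, 2 and all \<open>u\<^sub>i\<close> are closed under steps
  of the walk, and 1 is not among them.\<close>

lemma ppr_unswapped: 
  assumes "N > 0"
  shows "ppr \<alpha> (graph (hard_input N N)) 0 1 = 0"
proof -
  let ?W = "walk_pmf (graph (hard_input N N)) 0"
  \<comment> \<open>\<open>pmf_of_set\<close> has the intended support only for nonempty
    sets.\<close>
  have ne: "hard_out N N v \<noteq> []" if "v < 2 * N + 3" for v
    using that assms by (simp add: hard_out_def)
  have "set_pmf (?W i) \<subseteq> {0, 2} \<union> {v. odd v \<and> 3 \<le> v \<and> v < 2 * N + 3}" for i
  proof (induction i)
    case (Suc i)
    have "w \<in> {0, 2} \<union> {v. odd v \<and> 3 \<le> v \<and> v < 2 * N + 3}"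
      if "v \<in> set_pmf (?W i)" "w \<in> set_pmf (pmf_of_set (set (hard_out N N v)))" for v w
    proof -
      have v: "v \<in> {0, 2} \<union> {v. odd v \<and> 3 \<le> v \<and> v < 2 * N + 3}"
        using Suc that(1) by blast
      with ne[of v] that(2) have "w \<in> set (hard_out N N v)"
        by (subst (asm) set_pmf_of_set) auto
      with v show ?thesis
        by (auto simp: hard_out_def split: if_splits)
    qed
    then show ?case by auto
  qed simp
  then have "1 \<notin> set_pmf (?W i)" for i
    by fastforce
  then show ?thesis
    by (simp add: ppr_def pmf_eq_0_set_pmf)
qed

text \<open>Counts only the path from 0 through \<open>u\<^sub>j\<close> to 1: its first step has
  probability \<open>1 / N\<close>, its second is certain, and length 2 has probability
  \<open>\<alpha> * (1 - \<alpha>)\<^sup>2\<close>.\<close>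

lemma ppr_swapped:
  assumes "j < N" "0 < \<alpha>" "\<alpha> \<le> 1"
  shows "\<alpha> * (1 - \<alpha>)\<^sup>2 / N \<le> ppr \<alpha> (graph (hard_input N j)) 0 1"
proof -
  let ?W = "walk_pmf (graph (hard_input N j)) 0"
  let ?u = "2 * j + 3"
  have "card (set (hard_out N j 0)) = N"
    by (simp add: hard_out_def card_image inj_on_def)
  moreover have "set (hard_out N j 0) \<noteq> {}" "?u \<in> set (hard_out N j 0)"
    using assms(1) by (auto simp: hard_out_def)
  ultimately have "pmf (?W 1) ?u = 1 / N"
    by (simp add: bind_return_pmf)
  moreover have "pmf (pmf_of_set (set (hard_out N j ?u))) 1 = 1"
    using assms(1) by (simp add: hard_out_def)
  moreover have "?W 2 = bind_pmf (?W 1) (\<lambda>v. pmf_of_set (set (hard_out N j v)))"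
    unfolding numeral_2_eq_2 One_nat_def walk_pmf.simps out_nbrs_hard_input ..
  ultimately have "1 / N \<le> pmf (?W 2) 1"
    using pmf_bind_ge[of "?W 1" ?u "\<lambda>v. pmf_of_set (set (hard_out N j v))" 1]
    by (metis mult_1_right)
  then have "pmf (geometric_pmf \<alpha>) 2 * (1 / N) \<le> pmf (geometric_pmf \<alpha>) 2 * pmf (?W 2) 1"
    by (rule mult_left_mono) simp
  also have "\<dots> \<le> ppr \<alpha> (graph (hard_input N j)) 0 1"
    unfolding ppr_def by (rule pmf_bind_ge)
  finally show ?thesis
    using assms by (simp add: mult.commute)
qed

theorem theorem4:
  shows "\<exists>c>0. \<forall>\<^sub>F \<delta> in at_right (0::real).
           \<forall>A. solves_detect_high (1 / (100 * ln (1 / \<delta>))) \<delta> A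
             \<longrightarrow> ennreal (c / sqrt \<delta>) \<le> worst_case_edges A"
proof (intro exI conjI)
  \<comment> \<open>In the last conjunct, \<open>1 / sqrt \<delta> + 1\<close> bounds the rounded-up
    \<open>N\<close>; the right side has order \<open>sqrt \<delta> / ln (1 / \<delta>)\<close>,
    which dominates \<open>\<delta>\<close>.\<close>
  have "\<forall>\<^sub>F \<delta> in at_right (0::real). 0 < \<delta> \<and> 0 < 1 / (100 * ln (1 / \<delta>)) \<and> 1 / (100 * ln (1 / \<delta>)) < 1 \<and>
      \<delta> < 1 / (100 * ln (1 / \<delta>)) * (1 - 1 / (100 * ln (1 / \<delta>)))\<^sup>2 / (1 / sqrt \<delta> + 1)"
    by (intro eventually_conj; real_asymp)
  then show "\<forall>\<^sub>F \<delta> in at_right (0::real).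
           \<forall>A. solves_detect_high (1 / (100 * ln (1 / \<delta>))) \<delta> A
             \<longrightarrow> ennreal ((4 / 5) / sqrt \<delta>) \<le> worst_case_edges A"
  proof (eventually_elim, intro allI impI)
    fix \<delta> :: real and A
    define \<alpha> where "\<alpha> = 1 / (100 * ln (1 / \<delta>))"
    define N where "N = nat \<lceil>1 / sqrt \<delta>\<rceil>"
    assume "0 < \<delta> \<and> 0 < 1 / (100 * ln (1 / \<delta>)) \<and> 1 / (100 * ln (1 / \<delta>)) < 1 \<and>
      \<delta> < 1 / (100 * ln (1 / \<delta>)) * (1 - 1 / (100 * ln (1 / \<delta>)))\<^sup>2 / (1 / sqrt \<delta> + 1)"
      and "solves_detect_high (1 / (100 * ln (1 / \<delta>))) \<delta> A"
    then have \<delta>: "0 < \<delta>" "\<delta> < \<alpha> * (1 - \<alpha>)\<^sup>2 / (1 / sqrt \<delta> + 1)" and \<alpha>: "0 < \<alpha>" "\<alpha> < 1"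
      and A: "solves_detect_high \<alpha> \<delta> A"
      unfolding \<alpha>_def by auto
    have N: "1 / sqrt \<delta> \<le> N" "N \<le> 1 / sqrt \<delta> + 1" "N > 0"
      using \<delta>(1) by (auto simp: N_def)
    have valid: "valid_input (hard_input N j)" for j
      using N(3) by (rule valid_hard_input)
    have "output_prob A (hard_input N N) REJECT > 9 / 10"
      using A valid[of N] \<delta>(1) ppr_unswapped[OF N(3), of \<alpha>]
      by (auto simp: solves_detect_high_def)
    moreover have "output_prob A (hard_input N j) ACCEPT > 9 / 10" if "j < N" for j
    proof -
      note \<delta>(2)
      also have "\<alpha> * (1 - \<alpha>)\<^sup>2 / (1 / sqrt \<delta> + 1) \<le> \<alpha> * (1 - \<alpha>)\<^sup>2 / N"
        using N \<alpha> by (intro divide_left_mono) (auto intro!: mult_pos_pos add_pos_pos \<delta>)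
      also have "\<dots> \<le> ppr \<alpha> (graph (hard_input N j)) 0 1"
        using that \<alpha> by (intro ppr_swapped) auto
      finally show ?thesis
        using A valid[of j] by (auto simp: solves_detect_high_def)
    qed
    \<comment> \<open>The \<open>N\<close> possible swaps are played against the unswapped input;
      since \<open>N\<close> is at least \<open>1 / sqrt \<delta>\<close>, this yields the constant
      4/5.\<close>
    ultimately have "ennreal (4 / 5 * card {..<N}) \<le> expected_edges A (hard_input N N)"
      by (intro expected_edges_ge[of _ swap_edges _ "hard_input N"] disjoint_swap_edges)
        (auto intro: differ_on_hard_input)
    also have "\<dots> \<le> worst_case_edges A"
      unfolding worst_case_edges_def using valid by (intro SUP_upper) simp
    finally show "ennreal ((4 / 5) / sqrt \<delta>) \<le> worst_case_edges A"
      using N(1) by (elim order_trans[rotated]) (intro ennreal_leI, simp)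
  qed
qed simp

end
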